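(* Let $L$ be an arbitrary lattice. There exists a partial order $\preccurlyeq$ on the set of weak factorization systems on $L$ which refines $\leqslant$ (that is, $\mathcal{R} \preccurlyeq \mathcal{R}'$ implies $\mathcal{R} \leqslant \mathcal{R}'$) and such that, for $\mathcal{R} \leqslant \mathcal{R}'$, one has $\mathcal{R} \preccurlyeq \mathcal{R}'$ if and only if $\mathcal{R} \circ \mathcal{L}'$ is closed under composition.
   Context: A lattice $L$ is regarded as a category with exactly one morphism $x \to y$ when $x \leqslant y$ and none otherwise. A weak factorization system on $L$ is a pair $(\mathcal{L},\mathcal{R})$ of classes of morphisms such that: every morphism $f$ factors as $f = p i$ with $i \in \mathcal{L}$, $p \in \mathcal{R}$; every morphism in $\mathcal{L}$ has the left lifting property against every morphism in $\mathcal{R}$ (in a lattice: if $x \to y$ is in $\mathcal{L}$, $a \to b$ is in $\mathcal{R}$, $x \leqslant a$ and $y \leqslant b$, then $y \leqslant a$); and $\mathcal{L},\mathcal{R}$ are closed under retracts. A weak factorization system is determined by its right class, so it is denoted simply by $\mathcal{R}$; the left class corresponding to $\mathcal{R}'$ is denoted $\mathcal{L}'$. Write $\mathcal{R} \leqslant \mathcal{R}'$ if $\mathcal{R} \subseteq \mathcal{R}'$ (equivalently $\mathcal{L} \supseteq \mathcal{L}'$). $\mathcal{R} \circ \mathcal{L}'$ is the class of morphisms $x \to y$ for which there is $z$ with $x \to z$ in $\mathcal{L}'$ and $z \to y$ in $\mathcal{R}$. When $\mathcal{R}\leqslant\mathcal{R}'$, the pair is a premodel structure with weak equivalences $\mathcal{R}\circ\mathcal{L}'$,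 and it is called composition closed if $\mathcal{R}\circ\mathcal{L}'$ is closed under composition. *)

theory Defs
  imports Main
begin

type_synonym 'a class_pair = "('a \<times> 'a) set \<times> ('a \<times> 'a) set"

text \<open>
  A lattice is given by a type of class \<open>lattice\<close>, viewed as a category: the morphism
  from x to y, which exists iff x is below y, is the pair \<open>(x, y)\<close>.
\<close>

definition lat_morphisms :: "('a :: lattice \<times> 'a) set" where
  "lat_morphisms = {(x, y). x \<le> y}"

text \<open>
  In a category with at most one morphism between two objects every square commutes and
  every endomorphism is an identity, so a lifting problem is given by its two horizontal
  arrows, and a retract diagram by arrows back and forth between the
  sources and between the targets.
\<close>

definition lifts :: "'a :: lattice \<times> 'a \<Rightarrow> 'a \<times> 'a \<Rightarrow> bool" where
  "lifts f g \<longleftrightarrow>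
     (case f of (x, y) \<Rightarrow> case g of (a, b) \<Rightarrow> x \<le> a \<and> y \<le> b \<longrightarrow> y \<le> a)"

definition retract_of_morphism :: "'a :: lattice \<times> 'a \<Rightarrow> 'a \<times> 'a \<Rightarrow> bool" where
  "retract_of_morphism f g \<longleftrightarrow>
     (case f of (x, y) \<Rightarrow> case g of (a, b) \<Rightarrow> x \<le> a \<and> a \<le> x \<and> y \<le> b \<and> b \<le> y)"

definition closed_under_retracts :: "('a :: lattice \<times> 'a) set \<Rightarrow> bool" where
  "closed_under_retracts C \<longleftrightarrow>
     (\<forall>g\<in>C. \<forall>f\<in>lat_morphisms. retract_of_morphism f g \<longrightarrow> f \<in> C)"

text \<open>
  The factorization \<open>f = p i\<close> with i in the left and p in the right class reads
  \<open>f \<in> l O r\<close>, since \<open>(O)\<close> composes relations in diagrammatic order.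
\<close>

definition weak_factorization_system :: "('a :: lattice) class_pair \<Rightarrow> bool" where
  "weak_factorization_system W \<longleftrightarrow>
     (case W of (l, r) \<Rightarrow>
        l \<subseteq> lat_morphisms \<and> r \<subseteq> lat_morphisms \<and>
        (\<forall>f\<in>lat_morphisms. f \<in> l O r) \<and>
        (\<forall>f\<in>l. \<forall>g\<in>r. lifts f g) \<and>
        closed_under_retracts l \<and> closed_under_retracts r)"

definition WFS :: "('a :: lattice) class_pair set" where
  "WFS = {W. weak_factorization_system W}"

abbreviation left_class :: "'b set \<times> 'c set \<Rightarrow> 'b set" where
  "left_class \<equiv> fst"

abbreviation right_class :: "'b set \<times> 'c set \<Rightarrow> 'c set" where
  "right_class \<equiv> snd"

definition wfs_le :: "('a :: lattice) class_pair \<Rightarrow> 'a class_pair \<Rightarrow> bool" where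
  "wfs_le W W' \<longleftrightarrow> right_class W \<subseteq> right_class W'"

text \<open>
  The class of weak equivalences: a morphism of the left class of \<open>W'\<close>
  followed by one of the right class of \<open>W\<close>.
\<close>

definition weak_equivalences ::
    "('a :: lattice) class_pair \<Rightarrow> 'a class_pair \<Rightarrow> ('a \<times> 'a) set" where
  "weak_equivalences W W' = left_class W' O right_class W"

definition closed_under_composition :: "('a :: lattice \<times> 'a) set \<Rightarrow> bool" where
  "closed_under_composition C \<longleftrightarrow> (\<forall>x y z. (x, y) \<in> C \<and> (y, z) \<in> C \<longrightarrow> (x, z) \<in> C)"

end

theory Submission
  imports Defs
begin

text \<open>
  The content is transitivity. Given three weak factorization systems, a morphism of the first
  right class followed by one of the third left class has two other factorizations, one from each
  closure hypothesis. Both are factorizations for the middle system, and these are unique in a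
  poset; hence the two coincide and yield the required one.
\<close>

lemma WFS_left_le: "W \<in> WFS \<Longrightarrow> (x, y) \<in> left_class W \<Longrightarrow> x \<le> y"
  and WFS_right_le: "W \<in> WFS \<Longrightarrow> (x, y) \<in> right_class W \<Longrightarrow> x \<le> y"
  by (auto simp: WFS_def weak_factorization_system_def lat_morphisms_def)

lemma WFS_factor:
  assumes "W \<in> WFS" "x \<le> y"
  obtains u where "(x, u) \<in> left_class W" "(u, y) \<in> right_class W"
proof -
  have "(x, y) \<in> lat_morphisms"
    using assms(2) by (simp add: lat_morphisms_def)
  then have "(x, y) \<in> left_class W O right_class W"
    using assms(1) unfolding WFS_def weak_factorization_system_def case_prod_beta by blast
  then show thesis
    using that by blast
qed

lemma WFS_lift:
  assumes "W \<in> WFS" "(x, y) \<in> left_class W" "(a, b) \<in> right_class W" "x \<le> a" "y \<le> b"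
  shows "y \<le> a"
proof -
  have "lifts (x, y) (a, b)"
    using assms(1,2,3) unfolding WFS_def weak_factorization_system_def case_prod_beta by blast
  then show ?thesis
    using assms(4,5) by (simp add: lifts_def)
qed

text \<open>The retract argument: a morphism with the lifting property is factored and lifted
  against its own right factor, which therefore collapses to an identity. Membership in the left
  class becomes a lifting condition against the right class alone.\<close>

lemma WFS_left_iff:
  assumes W: "W \<in> WFS"
  shows "(x, y) \<in> left_class W \<longleftrightarrow> x \<le> y \<and> (\<forall>(a, b)\<in>right_class W. x \<le> a \<and> y \<le> b \<longrightarrow> y \<le> a)"
proof
  assume "(x, y) \<in> left_class W"
  then show "x \<le> y \<and> (\<forall>(a, b)\<in>right_class W. x \<le> a \<and> y \<le> b \<longrightarrow> y \<le> a)"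
    using WFS_left_le[OF W] WFS_lift[OF W] by blast
next
  assume lifting: "x \<le> y \<and> (\<forall>(a, b)\<in>right_class W. x \<le> a \<and> y \<le> b \<longrightarrow> y \<le> a)"
  then obtain u where u: "(x, u) \<in> left_class W" "(u, y) \<in> right_class W"
    using WFS_factor[OF W] by blast
  \<comment> \<open>Instantiating the lifting property at the right factor \<open>(u, y)\<close>
    gives y \<le> u.\<close>
  then have "u = y"
    using lifting WFS_left_le[OF W u(1)] WFS_right_le[OF W u(2)] by fastforce
  with u show "(x, y) \<in> left_class W" by simp
qed

text \<open>Dual argument: lifting the left factor of \<open>(a, b)\<close> against
  \<open>(a, b)\<close> itself collapses that factor.\<close>

lemma WFS_right_iff:
  assumes W: "W \<in> WFS"
  shows "(a, b) \<in> right_class W \<longleftrightarrow> a \<le> b \<and> (\<forall>(x, y)\<in>left_class W. x \<le> a \<and> y \<le> b \<longrightarrow> y \<le> a)"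
proof
  assume "(a, b) \<in> right_class W"
  then show "a \<le> b \<and> (\<forall>(x, y)\<in>left_class W. x \<le> a \<and> y \<le> b \<longrightarrow> y \<le> a)"
    using WFS_right_le[OF W] WFS_lift[OF W] by blast
next
  assume lifting: "a \<le> b \<and> (\<forall>(x, y)\<in>left_class W. x \<le> a \<and> y \<le> b \<longrightarrow> y \<le> a)"
  then obtain u where u: "(a, u) \<in> left_class W" "(u, b) \<in> right_class W"
    using WFS_factor[OF W] by blast
  then have "u = a"
    using lifting WFS_left_le[OF W u(1)] WFS_right_le[OF W u(2)] by fastforce
  with u show "(a, b) \<in> right_class W" by simp
qed

text \<open>A lift against \<open>(a, b)\<close> is built in two stages: lifting
  \<open>(x, y)\<close> gives y \<le> a, which is the upper edge needed to lift
  \<open>(y, z)\<close>.\<close>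

lemma WFS_left_trans:
  assumes W: "W \<in> WFS" and xy: "(x, y) \<in> left_class W" and yz: "(y, z) \<in> left_class W"
  shows "(x, z) \<in> left_class W"
proof -
  have le: "x \<le> y" "y \<le> z" using WFS_left_le[OF W] xy yz by blast+
  have "z \<le> a" if ab: "(a, b) \<in> right_class W" and "x \<le> a" "z \<le> b" for a b
    using WFS_lift[OF W yz ab WFS_lift[OF W xy ab]] that le order_trans[of y z b] by blast
  then show ?thesis
    using le unfolding WFS_left_iff[OF W] by (blast intro: order_trans)
qed

text \<open>Again two stages: lifting against \<open>(b, c)\<close> gives y \<le> b, which is the
  lower edge of the square over \<open>(a, b)\<close>.\<close>

lemma WFS_right_trans:
  assumes W: "W \<in> WFS" and ab: "(a, b) \<in> right_class W" and bc: "(b, c) \<in> right_class W"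
  shows "(a, c) \<in> right_class W"
proof -
  have le: "a \<le> b" "b \<le> c" using WFS_right_le[OF W] ab bc by blast+
  have "y \<le> a" if xy: "(x, y) \<in> left_class W" and "x \<le> a" "y \<le> c" for x y
    using WFS_lift[OF W xy ab _ WFS_lift[OF W xy bc]] that le order_trans[of x a b] by blast
  then show ?thesis
    using le unfolding WFS_right_iff[OF W] by (blast intro: order_trans)
qed

text \<open>A larger right class imposes more lifting conditions on the left class.\<close>

lemma WFS_left_antimono:
  assumes "W \<in> WFS" "W' \<in> WFS" "wfs_le W W'"
  shows "left_class W' \<subseteq> left_class W"
proof (rule subrelI)
  fix x y
  assume "(x, y) \<in> left_class W'"
  then show "(x, y) \<in> left_class W"
    using assms(3) unfolding wfs_le_def WFS_left_iff[OF assms(1)] WFS_left_iff[OF assms(2)]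
    by blast
qed

lemma wfs_le_antisym:
  assumes "W \<in> WFS" "W' \<in> WFS" "wfs_le W W'" "wfs_le W' W"
  shows "W = W'"
  using assms WFS_left_antimono[of W W'] WFS_left_antimono[of W' W]
  by (simp add: wfs_le_def prod_eq_iff)

text \<open>The left half of each factorization lifts against the right half of the other, so each
  midpoint lies below the other.\<close>

lemma WFS_factor_unique:
  assumes W: "W \<in> WFS"
    and u: "(x, u) \<in> left_class W" "(u, y) \<in> right_class W"
    and v: "(x, v) \<in> left_class W" "(v, y) \<in> right_class W"
  shows "u = v"
proof (rule antisym)
  show "u \<le> v"
    using WFS_lift[OF W u(1) v(2)] WFS_left_le[OF W v(1)] WFS_right_le[OF W u(2)] .
  show "v \<le> u"
    using WFS_lift[OF W v(1) u(2)] WFS_left_le[OF W u(1)] WFS_right_le[OF W v(2)] .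
qed

lemma WFS_id:
  assumes "W \<in> WFS"
  shows "(x, x) \<in> left_class W" "(x, x) \<in> right_class W"
  by (auto simp: WFS_left_iff WFS_right_iff assms)

text \<open>A composite of two weak equivalences is a chain left, right, left, right. Once the inner
  right-left pair is rewritten as left-right, the adjacent lefts and the adjacent rights compose
  within their classes. Conversely, padding with identities makes every morphism of either class a
  weak equivalence.\<close>

lemma closed_weak_equivalences_iff:
  assumes W: "W \<in> WFS" and W': "W' \<in> WFS"
  shows "closed_under_composition (weak_equivalences W W') \<longleftrightarrow>
    right_class W O left_class W' \<subseteq> weak_equivalences W W'"
proof
  assume "closed_under_composition (weak_equivalences W W')"
  then show "right_class W O left_class W' \<subseteq> weak_equivalences W W'"
    using WFS_id(1)[OF W'] WFS_id(2)[OF W]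
    unfolding closed_under_composition_def weak_equivalences_def by blast
next
  assume swap: "right_class W O left_class W' \<subseteq> weak_equivalences W W'"
  have "(x, z) \<in> weak_equivalences W W'"
    if xy: "(x, y) \<in> weak_equivalences W W'" and yz: "(y, z) \<in> weak_equivalences W W'" for x y z
  proof -
    obtain u where u: "(x, u) \<in> left_class W'" "(u, y) \<in> right_class W"
      using xy unfolding weak_equivalences_def by blast
    obtain v where v: "(y, v) \<in> left_class W'" "(v, z) \<in> right_class W"
      using yz unfolding weak_equivalences_def by blast
    obtain w where w: "(u, w) \<in> left_class W'" "(w, v) \<in> right_class W"
      using swap u(2) v(1) unfolding weak_equivalences_def by blast
    show ?thesis
      using WFS_left_trans[OF W' u(1) w(1)] WFS_right_trans[OF W w(2) v(2)]
      unfolding weak_equivalences_def by (rule relcompI)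
  qed
  then show "closed_under_composition (weak_equivalences W W')"
    unfolding closed_under_composition_def by blast
qed

text \<open>With both systems equal, the factorization axiom makes every morphism a weak
  equivalence.\<close>

lemma closed_weak_equivalences_refl:
  assumes W: "W \<in> WFS"
  shows "closed_under_composition (weak_equivalences W W)"
proof -
  have "(x, z) \<in> left_class W O right_class W"
    if "(x, y) \<in> right_class W" "(y, z) \<in> left_class W" for x y z
  proof -
    have "x \<le> z"
      using WFS_right_le[OF W that(1)] WFS_left_le[OF W that(2)] by (rule order_trans)
    then show ?thesis
      using WFS_factor[OF W] by blast
  qed
  then show ?thesis
    unfolding closed_weak_equivalences_iff[OF W W] unfolding weak_equivalences_def by blast
qed

lemma closed_weak_equivalences_trans:
  assumes W1: "W1 \<in> WFS" and W2: "W2 \<in> WFS" and W3: "W3 \<in> WFS"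
    and le12: "wfs_le W1 W2" and le23: "wfs_le W2 W3"
    and c12: "closed_under_composition (weak_equivalences W1 W2)"
    and c23: "closed_under_composition (weak_equivalences W2 W3)"
  shows "closed_under_composition (weak_equivalences W1 W3)"
  unfolding closed_weak_equivalences_iff[OF W1 W3]
proof clarify
  fix x y z
  assume xy: "(x, y) \<in> right_class W1" and yz: "(y, z) \<in> left_class W3"
  have R12: "right_class W1 \<subseteq> right_class W2"
    using le12 by (simp add: wfs_le_def)
  have L32: "left_class W3 \<subseteq> left_class W2"
    using WFS_left_antimono[OF W2 W3 le23] .
  \<comment> \<open>By \<open>L32\<close> the second morphism is also in the left class of
    \<open>W2\<close>, so the exchange for the first pair of systems applies.\<close>
  obtain u where u: "(x, u) \<in> left_class W2" "(u, z) \<in> right_class W1"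
    using c12 xy yz L32 unfolding closed_weak_equivalences_iff[OF W1 W2]
    unfolding weak_equivalences_def by blast
  \<comment> \<open>Symmetrically, \<open>R12\<close> puts the first morphism in the right class of
    \<open>W2\<close>.\<close>
  obtain v where v: "(x, v) \<in> left_class W3" "(v, z) \<in> right_class W2"
    using c23 xy yz R12 unfolding closed_weak_equivalences_iff[OF W2 W3]
    unfolding weak_equivalences_def by blast
  have "u = v"
    using WFS_factor_unique[OF W2 u(1)] u(2) v R12 L32 by blast
  \<comment> \<open>The common midpoint takes its left half from \<open>v\<close> and its right half
    from \<open>u\<close>.\<close>
  with u v show "(x, z) \<in> weak_equivalences W1 W3"
    unfolding weak_equivalences_def by blast
qed

theorem corollary3p3:
  shows "\<exists>prec :: (('a :: lattice) class_pair \<times> 'a class_pair) set.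
    partial_order_on WFS prec \<and>
    (\<forall>W\<in>WFS. \<forall>W'\<in>WFS. (W, W') \<in> prec \<longrightarrow> wfs_le W W') \<and>
    (\<forall>W\<in>WFS. \<forall>W'\<in>WFS. wfs_le W W' \<longrightarrow>
      ((W, W') \<in> prec \<longleftrightarrow> closed_under_composition (weak_equivalences W W')))"
proof -
  \<comment> \<open>Including \<open>wfs_le\<close> in the relation gives refinement at once and
    lets antisymmetry be inherited from \<open>wfs_le\<close>; transitivity also relies on it,
    through the class inclusions.\<close>
  define prec :: "('a class_pair \<times> 'a class_pair) set" where
    "prec = {(W, W'). W \<in> WFS \<and> W' \<in> WFS \<and> wfs_le W W' \<and>
      closed_under_composition (weak_equivalences W W')}"
  have "prec \<subseteq> WFS \<times> WFS"
    by (auto simp: prec_def)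
  moreover have "refl_on WFS prec"
    by (auto simp: refl_on_def prec_def wfs_le_def closed_weak_equivalences_refl)
  moreover have "antisym prec"
    by (rule antisymI) (simp add: prec_def wfs_le_antisym)
  moreover have "trans prec"
  proof (rule transI)
    fix W1 W2 W3
    assume "(W1, W2) \<in> prec" "(W2, W3) \<in> prec"
    then show "(W1, W3) \<in> prec"
      using closed_weak_equivalences_trans[of W1 W2 W3] by (auto simp: prec_def wfs_le_def)
  qed
  ultimately have "partial_order_on WFS prec"
    by (simp add: partial_order_on_def preorder_on_def)
  then show ?thesis
    by (intro exI[of _ prec]) (simp add: prec_def)
qed

end
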